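(* Let $(Q,\circ)$ be a loop, and let $\alpha,\beta,\gamma$ be permutations of $Q$. 1. If $(Q,\circ)$ is an $(\varepsilon;\beta;\gamma)$-inverse loop, then ${}_1N^A_l={}_3N^A_l={}_2N^A_r={}_3N^A_r={}_1N^A_m$ and $N_l=N_r=N_m\unlhd Q$. 2. If $(Q,\circ)$ is an $(\alpha;\varepsilon;\gamma)$-inverse loop, then ${}_1N^A_l={}_3N^A_l={}_2N^A_m$, ${}_2N^A_r={}_3N^A_r={}_1N^A_m$ and $N_l=N_r=N_m$. 3. If $(Q,\circ)$ is an $(\alpha;\beta;\varepsilon)$-inverse loop, then ${}_1N^A_l={}_3N^A_l={}_2N^A_r={}_3N^A_r={}_2N^A_m$ and $N_l=N_r=N_m\unlhd Q$. 4. If $(Q,\circ)$ is an $(\alpha;\alpha^{-1};\gamma)$-inverse loop, then ${}_1N^A_l={}_3N^A_l={}_2N^A_r={}_3N^A_r={}_2N^A_m$ and $N_l=N_r=N_m\unlhd Q$. 5. If $(Q,\circ)$ is an $(\alpha;\beta;\alpha^{-1})$-inverse loop, then ${}_1N^A_l={}_3N^A_l={}_2N^A_m$, ${}_2N^A_r={}_3N^A_r={}_1N^A_m$ and $N_l=N_r=N_m$. 6. If $(Q,\circ)$ is an $(\alpha;\beta;\beta^{-1})$-inverse loop, then ${}_1N^A_l={}_3N^A_l={}_2N^A_r={}_3N^A_r={}_1N^A_m$ and $N_l=N_r=N_m\unlhd Q$.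
   Context: A loop is a quasigroup (a non-empty set with a binary operation for which $x\circ a=b$ and $a\circ y=b$ are uniquely solvable) with a two-sided identity element $1$. $\varepsilon$ is the identity permutation of $Q$. For permutations $\alpha,\beta,\gamma$ of $Q$, a quasigroup (loop) $(Q,\circ)$ is an $(\alpha,\beta,\gamma)$-inverse (also written $(\alpha;\beta;\gamma)$-inverse) quasigroup (loop) if $\alpha(x\circ y)\circ\beta x=\gamma y$ for all $x,y\in Q$. An autotopy is a triple $(\alpha,\beta,\gamma)$ of permutations of $Q$ with $\alpha x\circ\beta y=\gamma(x\circ y)$ for all $x,y$. $N^A_l,N^A_r,N^A_m$ are the groups of autotopies of the forms $(\alpha,\varepsilon,\gamma)$, $(\varepsilon,\beta,\gamma)$, $(\alpha,\beta,\varepsilon)$ respectively; ${}_iN^A_l$, ${}_iN^A_r$, ${}_iN^A_m$ is the group of $i$-th components of their elements. Garrison nuclei: $N_l=\{a:(a\circ x)\circ y=a\circ(x\circ y)\ \forall x,y\}$, $N_r=\{a:(x\circ y)\circ a=x\circ(y\circ a)\ \forall x,y\}$, $N_m=\{a:(x\circ a)\circ y=x\circ(a\circ y)\ \forall x,y\}$. $N\unlhd Q$ means that $N$ is a normal subloop of $Q$, i.e. the class containing $1$ of a normal congruence of $(Q,\circ)$ (an equivalence $\theta$ with $x\,\theta\,y\Leftrightarrow(z\circ x)\,\theta\,(z\circ y)\Leftrightarrow(x\circ z)\,\theta\,(y\circ z)$ for all $x,y,z$). *)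

theory Defs
  imports "HOL-Combinatorics.Permutations"
begin

locale quasigroup =
  fixes Q :: "'a set" and opr :: "'a \<Rightarrow> 'a \<Rightarrow> 'a" (infixl "\<cdot>" 70)
  assumes nonempty: "Q \<noteq> {}"
    and closed: "\<And>x y. x \<in> Q \<Longrightarrow> y \<in> Q \<Longrightarrow> x \<cdot> y \<in> Q"
    and left_solvable: "\<And>a b. a \<in> Q \<Longrightarrow> b \<in> Q \<Longrightarrow> \<exists>!x. x \<in> Q \<and> x \<cdot> a = b"
    and right_solvable: "\<And>a b. a \<in> Q \<Longrightarrow> b \<in> Q \<Longrightarrow> \<exists>!y. y \<in> Q \<and> a \<cdot> y = b"

locale loop = quasigroup +
  fixes e :: 'a
  assumes identity_closed: "e \<in> Q"
    and left_identity: "\<And>x. x \<in> Q \<Longrightarrow> e \<cdot> x = x"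
    and right_identity: "\<And>x. x \<in> Q \<Longrightarrow> x \<cdot> e = x"

text \<open>A permutation of \<open>Q\<close> is represented by its extension to the whole type that is the identity
  outside \<open>Q\<close> (this is what \<open>permutes\<close> demands). Hence permutations of \<open>Q\<close> are equal iff
  they agree on \<open>Q\<close>, the identity permutation of \<open>Q\<close> is \<open>id\<close>, and the inverse of \<open>\<alpha>\<close> is \<open>inv \<alpha>\<close>.\<close>

locale inverse_quasigroup = quasigroup +
  fixes \<alpha> \<beta> \<gamma> :: "'a \<Rightarrow> 'a"
  assumes perm_alpha: "\<alpha> permutes Q"
    and perm_beta: "\<beta> permutes Q"
    and perm_gamma: "\<gamma> permutes Q"
    and inverse_law: "\<And>x y. x \<in> Q \<Longrightarrow> y \<in> Q \<Longrightarrow> \<alpha> (x \<cdot> y) \<cdot> \<beta> x = \<gamma> y"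

locale inverse_loop = loop Q opr e + inverse_quasigroup Q opr \<alpha> \<beta> \<gamma>
  for Q :: "'a set" and opr :: "'a \<Rightarrow> 'a \<Rightarrow> 'a" (infixl "\<cdot>" 70) and e :: 'a
    and \<alpha> \<beta> \<gamma> :: "'a \<Rightarrow> 'a"

type_synonym 'a perm_triple = "('a \<Rightarrow> 'a) \<times> ('a \<Rightarrow> 'a) \<times> ('a \<Rightarrow> 'a)"

definition autotopies :: "'a set \<Rightarrow> ('a \<Rightarrow> 'a \<Rightarrow> 'a) \<Rightarrow> 'a perm_triple set" where
  "autotopies Q f = {(\<alpha>, \<beta>, \<gamma>). \<alpha> permutes Q \<and> \<beta> permutes Q \<and> \<gamma> permutes Q \<and>
     (\<forall>x\<in>Q. \<forall>y\<in>Q. f (\<alpha> x) (\<beta> y) = \<gamma> (f x y))}"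

text \<open>The autotopy nuclei and their component groups are given by their underlying sets. All of them
  are groups under (componentwise) composition of permutations, so equality of component groups is
  equality of these sets.\<close>

definition left_autotopy_nucleus :: "'a set \<Rightarrow> ('a \<Rightarrow> 'a \<Rightarrow> 'a) \<Rightarrow> 'a perm_triple set" where
  "left_autotopy_nucleus Q f = {(\<alpha>, \<beta>, \<gamma>). (\<alpha>, \<beta>, \<gamma>) \<in> autotopies Q f \<and> \<beta> = id}"

definition right_autotopy_nucleus :: "'a set \<Rightarrow> ('a \<Rightarrow> 'a \<Rightarrow> 'a) \<Rightarrow> 'a perm_triple set" where
  "right_autotopy_nucleus Q f = {(\<alpha>, \<beta>, \<gamma>). (\<alpha>, \<beta>, \<gamma>) \<in> autotopies Q f \<and> \<alpha> = id}"

definition middle_autotopy_nucleus :: "'a set \<Rightarrow> ('a \<Rightarrow> 'a \<Rightarrow> 'a) \<Rightarrow> 'a perm_triple set" where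
  "middle_autotopy_nucleus Q f = {(\<alpha>, \<beta>, \<gamma>). (\<alpha>, \<beta>, \<gamma>) \<in> autotopies Q f \<and> \<gamma> = id}"

definition comp1 :: "'a perm_triple set \<Rightarrow> ('a \<Rightarrow> 'a) set" where
  "comp1 T = (\<lambda>(\<alpha>, \<beta>, \<gamma>). \<alpha>) ` T"

definition comp2 :: "'a perm_triple set \<Rightarrow> ('a \<Rightarrow> 'a) set" where
  "comp2 T = (\<lambda>(\<alpha>, \<beta>, \<gamma>). \<beta>) ` T"

definition comp3 :: "'a perm_triple set \<Rightarrow> ('a \<Rightarrow> 'a) set" where
  "comp3 T = (\<lambda>(\<alpha>, \<beta>, \<gamma>). \<gamma>) ` T"

definition left_nucleus :: "'a set \<Rightarrow> ('a \<Rightarrow> 'a \<Rightarrow> 'a) \<Rightarrow> 'a set" where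
  "left_nucleus Q f = {a \<in> Q. \<forall>x\<in>Q. \<forall>y\<in>Q. f (f a x) y = f a (f x y)}"

definition right_nucleus :: "'a set \<Rightarrow> ('a \<Rightarrow> 'a \<Rightarrow> 'a) \<Rightarrow> 'a set" where
  "right_nucleus Q f = {a \<in> Q. \<forall>x\<in>Q. \<forall>y\<in>Q. f (f x y) a = f x (f y a)}"

definition middle_nucleus :: "'a set \<Rightarrow> ('a \<Rightarrow> 'a \<Rightarrow> 'a) \<Rightarrow> 'a set" where
  "middle_nucleus Q f = {a \<in> Q. \<forall>x\<in>Q. \<forall>y\<in>Q. f (f x a) y = f x (f a y)}"

definition normal_congruence :: "'a set \<Rightarrow> ('a \<Rightarrow> 'a \<Rightarrow> 'a) \<Rightarrow> ('a \<times> 'a) set \<Rightarrow> bool" where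
  "normal_congruence Q f \<theta> \<longleftrightarrow> equiv Q \<theta> \<and>
     (\<forall>x\<in>Q. \<forall>y\<in>Q. \<forall>z\<in>Q.
        ((x, y) \<in> \<theta> \<longleftrightarrow> (f z x, f z y) \<in> \<theta>) \<and>
        ((x, y) \<in> \<theta> \<longleftrightarrow> (f x z, f y z) \<in> \<theta>))"

definition normal_subloop :: "'a set \<Rightarrow> 'a set \<Rightarrow> ('a \<Rightarrow> 'a \<Rightarrow> 'a) \<Rightarrow> 'a \<Rightarrow> bool" where
  "normal_subloop N Q f e \<longleftrightarrow> (\<exists>\<theta>. normal_congruence Q f \<theta> \<and> N = \<theta> `` {e})"

end

theory Submission
  imports Defs
begin

text \<open>
  Write \<open>L\<^sub>a\<close>, \<open>R\<^sub>a\<close> for the translations of the loop. Evaluating the defining identities of the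
  autotopy nuclei at the identity element shows that their component groups are
  \<open>\<L> = {L\<^sub>a | a \<in> N\<^sub>l}\<close> (first and third components of the left nucleus),
  \<open>\<R> = {R\<^sub>a | a \<in> N\<^sub>r}\<close> (second and third components of the right nucleus),
  \<open>\<M>\<^sub>1 = {R\<^sub>a | a \<in> N\<^sub>m}\<close> and \<open>\<M>\<^sub>2 = {L\<^sub>a | a \<in> N\<^sub>m}\<close> (first and second components of the middle
  nucleus). Hence each nucleus of the loop is recovered from a component group by evaluation at
  the identity element.

  The inverse law says that if \<open>x \<cdot> y = z\<close>, then \<open>\<alpha> z \<cdot> \<beta> x = \<gamma> y\<close>. So a triple
  \<open>(f, g, h)\<close> is an autotopy iff \<open>(\<alpha> h \<alpha>\<inverse>, \<beta> f \<beta>\<inverse>, \<gamma> g \<gamma>\<inverse>)\<close> is one (lemma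
  \<open>autotopy_shift_iff\<close>). This shift maps the left autotopy nucleus onto the middle one, the middle
  one onto the right one, and the right one onto the left one. On components this reads
  \<open>\<M>\<^sub>1 = \<alpha> \<L> \<alpha>\<inverse>\<close>, \<open>\<M>\<^sub>2 = \<beta> \<L> \<beta>\<inverse>\<close>, \<open>\<R> = \<beta> \<M>\<^sub>1 \<beta>\<inverse> = \<gamma> \<M>\<^sub>2 \<gamma>\<inverse>\<close> and
  \<open>\<L> = \<alpha> \<R> \<alpha>\<inverse> = \<gamma> \<R> \<gamma>\<inverse>\<close>. If one of the three permutations is the identity, or two of them are
  mutually inverse, then these six equations yield the asserted equalities of component groups,
  and evaluation at the identity element yields those of the nuclei.

  If moreover \<open>\<L> = \<R>\<close>, then \<open>L\<^sub>a = R\<^sub>a\<close> for every \<open>a\<close> in the common nucleus, which is therefore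
  the centre of the loop; its cosets are the classes of a normal congruence.
\<close>

section \<open>Conjugation of permutations\<close>

text \<open>The conjugate \<open>p f p\<inverse>\<close>. Both \<open>p\<close> and \<open>f\<close> are maps of the whole type; for permutations of a
  set \<open>Q\<close> the result is again the identity outside \<open>Q\<close>.\<close>

definition conjugate :: "('a \<Rightarrow> 'a) \<Rightarrow> ('a \<Rightarrow> 'a) \<Rightarrow> 'a \<Rightarrow> 'a" where
  "conjugate p f = p \<circ> f \<circ> inv p"

lemma conjugate_permutes:
  assumes "p permutes Q" "f permutes Q"
  shows "conjugate p f permutes Q"
  unfolding conjugate_def using assms by (intro permutes_compose permutes_inv)

lemma conjugate_apply:
  assumes "p permutes Q"
  shows "conjugate p f (p x) = p (f x)"
  unfolding conjugate_def using permutes_inverses(2)[OF assms] by simp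

lemma conjugate_id_left [simp]: "conjugate id f = f"
  by (simp add: conjugate_def fun_eq_iff)

lemma conjugate_id_right:
  assumes "p permutes Q"
  shows "conjugate p id = id"
  unfolding conjugate_def using permutes_inverses(1)[OF assms] by auto

lemma conjugate_inv_conjugate:
  assumes "p permutes Q"
  shows "conjugate (inv p) (conjugate p f) = f"
  unfolding conjugate_def permutes_inv_inv[OF assms]
  using permutes_inverses[OF assms] by (simp add: fun_eq_iff)

lemma conjugate_conjugate_inv:
  assumes "p permutes Q"
  shows "conjugate p (conjugate (inv p) f) = f"
  unfolding conjugate_def permutes_inv_inv[OF assms]
  using permutes_inverses[OF assms] by (simp add: fun_eq_iff)

lemma conjugate_image_inv:
  assumes "p permutes Q"
  shows "conjugate (inv p) ` conjugate p ` A = A"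
  by (simp add: image_image conjugate_inv_conjugate[OF assms])

lemma conjugate_inv_image:
  assumes "p permutes Q"
  shows "conjugate p ` conjugate (inv p) ` A = A"
  by (simp add: image_image conjugate_conjugate_inv[OF assms])

text \<open>If conjugation by \<open>p\<close> matches membership in \<open>A\<close> with membership in \<open>B\<close>, then it maps \<open>A\<close>
  onto \<open>B\<close>, because every permutation is itself a conjugate by \<open>p\<close>.\<close>

lemma eq_conjugate_image:
  assumes p: "p permutes Q"
    and A: "\<And>f. f \<in> A \<Longrightarrow> f permutes Q"
    and B: "\<And>f. f \<in> B \<Longrightarrow> f permutes Q"
    and iff: "\<And>f. f permutes Q \<Longrightarrow> conjugate p f \<in> B \<longleftrightarrow> f \<in> A"
  shows "B = conjugate p ` A"
proof
  show "conjugate p ` A \<subseteq> B" using A iff by auto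
  show "B \<subseteq> conjugate p ` A"
  proof
    fix g assume g: "g \<in> B"
    have eq: "conjugate p (conjugate (inv p) g) = g"
      by (rule conjugate_conjugate_inv[OF p])
    have "conjugate (inv p) g permutes Q"
      using conjugate_permutes[OF permutes_inv[OF p] B[OF g]] .
    then have "conjugate (inv p) g \<in> A" using iff eq g by metis
    then show "g \<in> conjugate p ` A" using eq by (metis imageI)
  qed
qed

section \<open>Autotopy nuclei of a loop\<close>

lemma autotopyI:
  assumes "f permutes Q" "g permutes Q" "h permutes Q"
    and "\<And>x y. x \<in> Q \<Longrightarrow> y \<in> Q \<Longrightarrow> opr (f x) (g y) = h (opr x y)"
  shows "(f, g, h) \<in> autotopies Q opr"
  using assms by (simp add: autotopies_def)

lemma autotopyD:
  assumes "(f, g, h) \<in> autotopies Q opr"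
  shows "f permutes Q" "g permutes Q" "h permutes Q"
    and "\<And>x y. x \<in> Q \<Longrightarrow> y \<in> Q \<Longrightarrow> opr (f x) (g y) = h (opr x y)"
  using assms by (simp_all add: autotopies_def)

context loop
begin

lemma left_cancel: "a \<in> Q \<Longrightarrow> x \<in> Q \<Longrightarrow> y \<in> Q \<Longrightarrow> a \<cdot> x = a \<cdot> y \<longleftrightarrow> x = y"
  using right_solvable[of a "a \<cdot> y"] closed by blast

lemma right_cancel: "a \<in> Q \<Longrightarrow> x \<in> Q \<Longrightarrow> y \<in> Q \<Longrightarrow> x \<cdot> a = y \<cdot> a \<longleftrightarrow> x = y"
  using left_solvable[of a "y \<cdot> a"] closed by blast

text \<open>The translations \<open>L\<^sub>a\<close> and \<open>R\<^sub>a\<close> by an element \<open>a\<close> of the loop, extended by the identity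
  outside \<open>Q\<close> so that they satisfy \<open>permutes\<close>.\<close>

definition left_translation :: "'a \<Rightarrow> 'a \<Rightarrow> 'a" where
  "left_translation a x = (if x \<in> Q then a \<cdot> x else x)"

definition right_translation :: "'a \<Rightarrow> 'a \<Rightarrow> 'a" where
  "right_translation a x = (if x \<in> Q then x \<cdot> a else x)"

lemma left_translation_permutes:
  assumes "a \<in> Q"
  shows "left_translation a permutes Q"
proof (rule bij_imp_permutes)
  show "bij_betw (left_translation a) Q Q"
    unfolding bij_betw_def inj_on_def left_translation_def
    using assms left_cancel closed right_solvable[OF assms] by (auto simp: image_iff) metis
qed (simp add: left_translation_def)

lemma right_translation_permutes:
  assumes "a \<in> Q"
  shows "right_translation a permutes Q"
proof (rule bij_imp_permutes)
  show "bij_betw (right_translation a) Q Q"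
    unfolding bij_betw_def inj_on_def right_translation_def
    using assms right_cancel closed left_solvable[OF assms] by (auto simp: image_iff) metis
qed (simp add: right_translation_def)

text \<open>The components of the autotopy nuclei; \<open>comp1\<close> and \<open>comp3\<close> agree on the left nucleus, and
  \<open>comp2\<close> and \<open>comp3\<close> on the right one.\<close>

lemma left_autotopy_components_eq:
  assumes "(f, id, h) \<in> autotopies Q (\<cdot>)"
  shows "f = h"
proof
  fix x
  note D = autotopyD[OF assms]
  show "f x = h x"
  proof (cases "x \<in> Q")
    case True
    then have "f x \<in> Q" using D(1) by (simp add: permutes_in_image)
    then show ?thesis using D(4)[OF True identity_closed] True right_identity by simp
  next
    case False
    then show ?thesis using D(1,3) by (simp add: permutes_not_in)
  qed
qed

lemma right_autotopy_components_eq: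
  assumes "(id, g, h) \<in> autotopies Q (\<cdot>)"
  shows "g = h"
proof
  fix x
  note D = autotopyD[OF assms]
  show "g x = h x"
  proof (cases "x \<in> Q")
    case True
    then have "g x \<in> Q" using D(2) by (simp add: permutes_in_image)
    then show ?thesis using D(4)[OF identity_closed True] True left_identity by simp
  next
    case False
    then show ?thesis using D(2,3) by (simp add: permutes_not_in)
  qed
qed

lemma mem_comp1_left_iff:
  "f \<in> comp1 (left_autotopy_nucleus Q (\<cdot>)) \<longleftrightarrow> (f, id, f) \<in> autotopies Q (\<cdot>)"
proof -
  have "f \<in> comp1 (left_autotopy_nucleus Q (\<cdot>)) \<longleftrightarrow> (\<exists>k. (f, id, k) \<in> autotopies Q (\<cdot>))"
    unfolding comp1_def left_autotopy_nucleus_def by force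
  then show ?thesis using left_autotopy_components_eq by metis
qed

lemma mem_comp3_left_iff:
  "f \<in> comp3 (left_autotopy_nucleus Q (\<cdot>)) \<longleftrightarrow> (f, id, f) \<in> autotopies Q (\<cdot>)"
proof -
  have "f \<in> comp3 (left_autotopy_nucleus Q (\<cdot>)) \<longleftrightarrow> (\<exists>k. (k, id, f) \<in> autotopies Q (\<cdot>))"
    unfolding comp3_def left_autotopy_nucleus_def by force
  then show ?thesis using left_autotopy_components_eq by metis
qed

lemma mem_comp2_right_iff:
  "f \<in> comp2 (right_autotopy_nucleus Q (\<cdot>)) \<longleftrightarrow> (id, f, f) \<in> autotopies Q (\<cdot>)"
proof -
  have "f \<in> comp2 (right_autotopy_nucleus Q (\<cdot>)) \<longleftrightarrow> (\<exists>k. (id, f, k) \<in> autotopies Q (\<cdot>))"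
    unfolding comp2_def right_autotopy_nucleus_def by force
  then show ?thesis using right_autotopy_components_eq by metis
qed

lemma mem_comp3_right_iff:
  "f \<in> comp3 (right_autotopy_nucleus Q (\<cdot>)) \<longleftrightarrow> (id, f, f) \<in> autotopies Q (\<cdot>)"
proof -
  have "f \<in> comp3 (right_autotopy_nucleus Q (\<cdot>)) \<longleftrightarrow> (\<exists>k. (id, k, f) \<in> autotopies Q (\<cdot>))"
    unfolding comp3_def right_autotopy_nucleus_def by force
  then show ?thesis using right_autotopy_components_eq by metis
qed

lemma mem_comp1_middle_iff:
  "f \<in> comp1 (middle_autotopy_nucleus Q (\<cdot>)) \<longleftrightarrow> (\<exists>g. (f, g, id) \<in> autotopies Q (\<cdot>))"
  unfolding comp1_def middle_autotopy_nucleus_def by force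

lemma mem_comp2_middle_iff:
  "g \<in> comp2 (middle_autotopy_nucleus Q (\<cdot>)) \<longleftrightarrow> (\<exists>f. (f, g, id) \<in> autotopies Q (\<cdot>))"
  unfolding comp2_def middle_autotopy_nucleus_def by force

lemma comp1_left_eq_comp3_left:
  "comp1 (left_autotopy_nucleus Q (\<cdot>)) = comp3 (left_autotopy_nucleus Q (\<cdot>))"
  by (auto simp: mem_comp1_left_iff mem_comp3_left_iff)

lemma comp2_right_eq_comp3_right:
  "comp2 (right_autotopy_nucleus Q (\<cdot>)) = comp3 (right_autotopy_nucleus Q (\<cdot>))"
  by (auto simp: mem_comp2_right_iff mem_comp3_right_iff)

section \<open>Nuclei as values of autotopies at the identity element\<close>

text \<open>Left autotopies are left translations, right autotopies are right translations.\<close>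

lemma left_autotopy_apply:
  assumes "(f, id, f) \<in> autotopies Q (\<cdot>)" "x \<in> Q"
  shows "f x = f e \<cdot> x"
  using autotopyD(4)[OF assms(1) identity_closed assms(2)] left_identity assms(2) by simp

lemma right_autotopy_apply:
  assumes "(id, f, f) \<in> autotopies Q (\<cdot>)" "x \<in> Q"
  shows "f x = x \<cdot> f e"
  using autotopyD(4)[OF assms(1) assms(2) identity_closed] right_identity assms(2) by simp

lemma left_nucleus_eq_image:
  "left_nucleus Q (\<cdot>) = (\<lambda>f. f e) ` comp3 (left_autotopy_nucleus Q (\<cdot>))" (is "_ = ?R")
proof (intro equalityI subsetI)
  fix a assume a: "a \<in> left_nucleus Q (\<cdot>)"
  then have aQ: "a \<in> Q" by (simp add: left_nucleus_def)
  have "(left_translation a, id, left_translation a) \<in> autotopies Q (\<cdot>)"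
    using a aQ closed left_translation_permutes
    by (intro autotopyI) (auto simp: left_translation_def left_nucleus_def permutes_id)
  moreover have "left_translation a e = a"
    using aQ identity_closed right_identity by (simp add: left_translation_def)
  ultimately show "a \<in> ?R"
    by (metis (no_types, lifting) image_eqI mem_comp3_left_iff)
next
  fix a assume "a \<in> ?R"
  then obtain f where a: "a = f e" and f: "(f, id, f) \<in> autotopies Q (\<cdot>)"
    by (auto simp: mem_comp3_left_iff)
  have "a \<in> Q" using autotopyD(1)[OF f] identity_closed by (simp add: a permutes_in_image)
  moreover have "(a \<cdot> x) \<cdot> y = a \<cdot> (x \<cdot> y)" if "x \<in> Q" "y \<in> Q" for x y
    using autotopyD(4)[OF f that] left_autotopy_apply[OF f] that closed by (simp add: a)
  ultimately show "a \<in> left_nucleus Q (\<cdot>)" by (simp add: left_nucleus_def)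
qed

lemma right_nucleus_eq_image:
  "right_nucleus Q (\<cdot>) = (\<lambda>f. f e) ` comp3 (right_autotopy_nucleus Q (\<cdot>))" (is "_ = ?R")
proof (intro equalityI subsetI)
  fix a assume a: "a \<in> right_nucleus Q (\<cdot>)"
  then have aQ: "a \<in> Q" by (simp add: right_nucleus_def)
  have "(id, right_translation a, right_translation a) \<in> autotopies Q (\<cdot>)"
    using a aQ closed right_translation_permutes
    by (intro autotopyI) (auto simp: right_translation_def right_nucleus_def permutes_id)
  moreover have "right_translation a e = a"
    using aQ identity_closed left_identity by (simp add: right_translation_def)
  ultimately show "a \<in> ?R"
    by (metis (no_types, lifting) image_eqI mem_comp3_right_iff)
next
  fix a assume "a \<in> ?R"
  then obtain f where a: "a = f e" and f: "(id, f, f) \<in> autotopies Q (\<cdot>)"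
    by (auto simp: mem_comp3_right_iff)
  have "a \<in> Q" using autotopyD(2)[OF f] identity_closed by (simp add: a permutes_in_image)
  moreover have "(x \<cdot> y) \<cdot> a = x \<cdot> (y \<cdot> a)" if "x \<in> Q" "y \<in> Q" for x y
    using autotopyD(4)[OF f that] right_autotopy_apply[OF f] that closed by (simp add: a)
  ultimately show "a \<in> right_nucleus Q (\<cdot>)" by (simp add: right_nucleus_def)
qed

text \<open>A middle autotopy has the form \<open>(R\<^sub>a, L\<^sub>a\<inverse>, \<epsilon>)\<close> and, since \<open>a\<inverse>\<close> is again in the middle
  nucleus, also the form \<open>(R\<^sub>b\<inverse>, L\<^sub>b, \<epsilon>)\<close>. So either component determines the middle nucleus.\<close>

lemma middle_nucleus_eq_image_comp1:
  "middle_nucleus Q (\<cdot>) = (\<lambda>f. f e) ` comp1 (middle_autotopy_nucleus Q (\<cdot>))" (is "_ = ?R")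
proof (intro equalityI subsetI)
  fix a assume a: "a \<in> middle_nucleus Q (\<cdot>)"
  then have aQ: "a \<in> Q" by (simp add: middle_nucleus_def)
  let ?l = "inv (left_translation a)"
  note perm = left_translation_permutes[OF aQ]
  have "(right_translation a, ?l, id) \<in> autotopies Q (\<cdot>)"
  proof (rule autotopyI)
    fix x y assume x: "x \<in> Q" and y: "y \<in> Q"
    have l: "?l y \<in> Q" using permutes_in_image[OF permutes_inv[OF perm]] y by simp
    have "a \<cdot> ?l y = y"
      using permutes_inverses(1)[OF perm, of y] l by (simp add: left_translation_def)
    then show "right_translation a x \<cdot> ?l y = id (x \<cdot> y)"
      using a x l by (simp add: right_translation_def middle_nucleus_def)
  qed (use right_translation_permutes[OF aQ] permutes_inv[OF perm] permutes_id in auto)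
  moreover have "right_translation a e = a"
    using aQ identity_closed left_identity by (simp add: right_translation_def)
  ultimately show "a \<in> ?R"
    by (metis (no_types, lifting) image_eqI mem_comp1_middle_iff)
next
  fix a assume "a \<in> ?R"
  then obtain f g where a: "a = f e" and fg: "(f, g, id) \<in> autotopies Q (\<cdot>)"
    by (auto simp: mem_comp1_middle_iff)
  note D = autotopyD[OF fg]
  have aQ: "a \<in> Q" using D(1) identity_closed by (simp add: a permutes_in_image)
  have "f x \<cdot> u = x \<cdot> (a \<cdot> u)" if "x \<in> Q" "u \<in> Q" for x u
  proof -
    obtain y where y: "y \<in> Q" "u = g y"
      using permutes_image[OF D(2)] \<open>u \<in> Q\<close> by blast
    have "a \<cdot> u = y" using D(4)[OF identity_closed y(1)] left_identity y by (simp add: a)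
    then show ?thesis using D(4)[OF \<open>x \<in> Q\<close> y(1)] y by simp
  qed
  note shift = this
  have "f x = x \<cdot> a" if "x \<in> Q" for x
    using shift[OF that identity_closed] right_identity aQ permutes_in_image[OF D(1)] that by simp
  then show "a \<in> middle_nucleus Q (\<cdot>)"
    using aQ shift by (simp add: middle_nucleus_def)
qed

lemma middle_nucleus_eq_image_comp2:
  "middle_nucleus Q (\<cdot>) = (\<lambda>f. f e) ` comp2 (middle_autotopy_nucleus Q (\<cdot>))" (is "_ = ?R")
proof (intro equalityI subsetI)
  fix a assume a: "a \<in> middle_nucleus Q (\<cdot>)"
  then have aQ: "a \<in> Q" by (simp add: middle_nucleus_def)
  let ?r = "inv (right_translation a)"
  note perm = right_translation_permutes[OF aQ]
  have "(?r, left_translation a, id) \<in> autotopies Q (\<cdot>)"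
  proof (rule autotopyI)
    fix x y assume x: "x \<in> Q" and y: "y \<in> Q"
    have r: "?r x \<in> Q" using permutes_in_image[OF permutes_inv[OF perm]] x by simp
    have rx: "?r x \<cdot> a = x"
      using permutes_inverses(1)[OF perm, of x] r by (simp add: right_translation_def)
    have "(?r x \<cdot> a) \<cdot> y = ?r x \<cdot> (a \<cdot> y)" using a r y by (simp add: middle_nucleus_def)
    then show "?r x \<cdot> left_translation a y = id (x \<cdot> y)"
      using rx y by (simp add: left_translation_def)
  qed (use left_translation_permutes[OF aQ] permutes_inv[OF perm] permutes_id in auto)
  moreover have "left_translation a e = a"
    using aQ identity_closed right_identity by (simp add: left_translation_def)
  ultimately show "a \<in> ?R"
    by (metis (no_types, lifting) image_eqI mem_comp2_middle_iff)
next
  fix a assume "a \<in> ?R"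
  then obtain f g where a: "a = g e" and fg: "(f, g, id) \<in> autotopies Q (\<cdot>)"
    by (auto simp: mem_comp2_middle_iff)
  note D = autotopyD[OF fg]
  have aQ: "a \<in> Q" using D(2) identity_closed by (simp add: a permutes_in_image)
  have "u \<cdot> g y = (u \<cdot> a) \<cdot> y" if "u \<in> Q" "y \<in> Q" for u y
  proof -
    obtain x where x: "x \<in> Q" "u = f x"
      using permutes_image[OF D(1)] \<open>u \<in> Q\<close> by blast
    have "u \<cdot> a = x" using D(4)[OF x(1) identity_closed] right_identity x by (simp add: a)
    then show ?thesis using D(4)[OF x(1) \<open>y \<in> Q\<close>] x by simp
  qed
  note shift = this
  have "g y = a \<cdot> y" if "y \<in> Q" for y
    using shift[OF identity_closed that] left_identity aQ permutes_in_image[OF D(2)] that by simp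
  then show "a \<in> middle_nucleus Q (\<cdot>)"
    using aQ shift by (simp add: middle_nucleus_def)
qed

section \<open>Normality of a central nucleus\<close>

lemma identity_in_left_nucleus: "e \<in> left_nucleus Q (\<cdot>)"
  using identity_closed left_identity closed by (simp add: left_nucleus_def)

lemma left_nucleus_closed:
  assumes "a \<in> left_nucleus Q (\<cdot>)" "b \<in> left_nucleus Q (\<cdot>)"
  shows "a \<cdot> b \<in> left_nucleus Q (\<cdot>)"
  using assms closed by (simp add: left_nucleus_def)

lemma left_nucleus_inverse:
  assumes a: "a \<in> left_nucleus Q (\<cdot>)"
  obtains b where "b \<in> left_nucleus Q (\<cdot>)" "a \<cdot> b = e" "b \<cdot> a = e"
proof -
  have aQ: "a \<in> Q" and assoc: "\<And>x y. x \<in> Q \<Longrightarrow> y \<in> Q \<Longrightarrow> (a \<cdot> x) \<cdot> y = a \<cdot> (x \<cdot> y)"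
    using a by (auto simp: left_nucleus_def)
  obtain b where bQ: "b \<in> Q" and ab: "a \<cdot> b = e"
    using right_solvable[OF aQ identity_closed] by blast
  have cancel: "a \<cdot> (b \<cdot> x) = x" if "x \<in> Q" for x
    using assoc[OF bQ that] ab left_identity[OF that] by simp
  have "(b \<cdot> x) \<cdot> y = b \<cdot> (x \<cdot> y)" if x: "x \<in> Q" and y: "y \<in> Q" for x y
  proof -
    have "a \<cdot> ((b \<cdot> x) \<cdot> y) = (a \<cdot> (b \<cdot> x)) \<cdot> y"
      using assoc[of "b \<cdot> x" y] x y bQ closed by simp
    also have "\<dots> = a \<cdot> (b \<cdot> (x \<cdot> y))" using cancel x y closed by simp
    finally have "a \<cdot> ((b \<cdot> x) \<cdot> y) = a \<cdot> (b \<cdot> (x \<cdot> y))" .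
    then show ?thesis using left_cancel aQ bQ x y closed by simp
  qed
  then have "b \<in> left_nucleus Q (\<cdot>)" using bQ by (simp add: left_nucleus_def)
  moreover have "b \<cdot> a = e"
    using left_cancel[of a "b \<cdot> a" e] cancel[OF aQ] right_identity[OF aQ] aQ bQ closed
      identity_closed by simp
  ultimately show thesis using ab that by blast
qed

text \<open>The congruence is the coset relation of the nucleus.\<close>

lemma normal_subloop_left_nucleus:
  assumes mid: "left_nucleus Q (\<cdot>) \<subseteq> middle_nucleus Q (\<cdot>)"
    and comm: "\<And>a x. a \<in> left_nucleus Q (\<cdot>) \<Longrightarrow> x \<in> Q \<Longrightarrow> a \<cdot> x = x \<cdot> a"
  shows "normal_subloop (left_nucleus Q (\<cdot>)) Q (\<cdot>) e"
proof -
  let ?N = "left_nucleus Q (\<cdot>)"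
  define \<theta> where "\<theta> = {(x, y). x \<in> Q \<and> y \<in> Q \<and> (\<exists>a\<in>?N. y = a \<cdot> x)}"
  have NQ: "a \<in> Q" if "a \<in> ?N" for a using that by (simp add: left_nucleus_def)
  have assoc: "(a \<cdot> x) \<cdot> y = a \<cdot> (x \<cdot> y)" if "a \<in> ?N" "x \<in> Q" "y \<in> Q" for a x y
    using that by (simp add: left_nucleus_def)
  have move: "z \<cdot> (a \<cdot> x) = a \<cdot> (z \<cdot> x)" if a: "a \<in> ?N" and x: "x \<in> Q" and z: "z \<in> Q" for a x z
  proof -
    have "z \<cdot> (a \<cdot> x) = (z \<cdot> a) \<cdot> x" using mid a x z by (auto simp: middle_nucleus_def)
    also have "\<dots> = (a \<cdot> z) \<cdot> x" using comm[OF a z] by simp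
    finally show ?thesis using assoc[OF a z x] by simp
  qed
  have "equiv Q \<theta>"
  proof (rule equivI)
    show "\<theta> \<subseteq> Q \<times> Q" by (auto simp: \<theta>_def)
    show "refl_on Q \<theta>"
      using identity_in_left_nucleus left_identity by (force simp: refl_on_def \<theta>_def)
    show "sym \<theta>"
    proof (rule symI)
      fix x y assume "(x, y) \<in> \<theta>"
      then obtain a where a: "a \<in> ?N" "y = a \<cdot> x" and xy: "x \<in> Q" "y \<in> Q"
        by (auto simp: \<theta>_def)
      obtain b where b: "b \<in> ?N" "b \<cdot> a = e" using left_nucleus_inverse[OF a(1)] by blast
      have "x = b \<cdot> y"
        using assoc[OF b(1) NQ[OF a(1)] xy(1)] b(2) a(2) left_identity[OF xy(1)] by simp
      then show "(y, x) \<in> \<theta>" using b xy by (auto simp: \<theta>_def)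
    qed
    show "trans \<theta>"
    proof (rule transI)
      fix x y z assume "(x, y) \<in> \<theta>" "(y, z) \<in> \<theta>"
      then obtain a b where a: "a \<in> ?N" "y = a \<cdot> x" and b: "b \<in> ?N" "z = b \<cdot> y"
        and xz: "x \<in> Q" "z \<in> Q"
        by (auto simp: \<theta>_def)
      have "z = (b \<cdot> a) \<cdot> x" using assoc[OF b(1) NQ[OF a(1)] xz(1)] a b by simp
      then show "(x, z) \<in> \<theta>" using left_nucleus_closed[OF b(1) a(1)] xz by (auto simp: \<theta>_def)
    qed
  qed
  moreover have "(x, y) \<in> \<theta> \<longleftrightarrow> (z \<cdot> x, z \<cdot> y) \<in> \<theta>" if "x \<in> Q" "y \<in> Q" "z \<in> Q" for x y z
  proof -
    have "y = a \<cdot> x \<longleftrightarrow> z \<cdot> y = a \<cdot> (z \<cdot> x)" if "a \<in> ?N" for a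
      using move[OF that \<open>x \<in> Q\<close> \<open>z \<in> Q\<close>] left_cancel[of z y "a \<cdot> x"] NQ[OF that]
        \<open>x \<in> Q\<close> \<open>y \<in> Q\<close> \<open>z \<in> Q\<close> closed by simp
    then show ?thesis using that closed by (simp add: \<theta>_def)
  qed
  moreover have "(x, y) \<in> \<theta> \<longleftrightarrow> (x \<cdot> z, y \<cdot> z) \<in> \<theta>" if "x \<in> Q" "y \<in> Q" "z \<in> Q" for x y z
  proof -
    have "y = a \<cdot> x \<longleftrightarrow> y \<cdot> z = a \<cdot> (x \<cdot> z)" if "a \<in> ?N" for a
      using assoc[OF that \<open>x \<in> Q\<close> \<open>z \<in> Q\<close>] right_cancel[of z y "a \<cdot> x"] NQ[OF that]
        \<open>x \<in> Q\<close> \<open>y \<in> Q\<close> \<open>z \<in> Q\<close> closed by simp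
    then show ?thesis using that closed by (simp add: \<theta>_def)
  qed
  ultimately have "normal_congruence Q (\<cdot>) \<theta>" unfolding normal_congruence_def by blast
  moreover have "?N = \<theta> `` {e}"
    using NQ identity_closed right_identity by (auto simp: \<theta>_def)
  ultimately show ?thesis unfolding normal_subloop_def by blast
qed

text \<open>Equality of the left and right component groups means \<open>L\<^sub>a = R\<^sub>a\<close> for all nuclear \<open>a\<close>.\<close>

lemma normal_subloop_middle_nucleus:
  assumes LR: "comp3 (left_autotopy_nucleus Q (\<cdot>)) = comp3 (right_autotopy_nucleus Q (\<cdot>))"
    and eq: "left_nucleus Q (\<cdot>) = middle_nucleus Q (\<cdot>)"
  shows "normal_subloop (middle_nucleus Q (\<cdot>)) Q (\<cdot>) e"
proof -
  have "a \<cdot> x = x \<cdot> a" if a: "a \<in> left_nucleus Q (\<cdot>)" and x: "x \<in> Q" for a x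
  proof -
    obtain f where f: "f \<in> comp3 (left_autotopy_nucleus Q (\<cdot>))" "a = f e"
      using a left_nucleus_eq_image by auto
    have "f x = a \<cdot> x" using f x left_autotopy_apply by (simp add: mem_comp3_left_iff)
    moreover have "f x = x \<cdot> a"
      using f x right_autotopy_apply unfolding LR by (simp add: mem_comp3_right_iff)
    ultimately show ?thesis by simp
  qed
  then have "normal_subloop (left_nucleus Q (\<cdot>)) Q (\<cdot>) e"
    using eq by (intro normal_subloop_left_nucleus) auto
  then show ?thesis by (simp only: eq)
qed

end

section \<open>The shift of autotopies of an inverse loop\<close>

context inverse_loop
begin

text \<open>By the inverse law, \<open>(x, y, z) \<mapsto> (\<alpha> z, \<beta> x, \<gamma> y)\<close> is a bijection of the triples with
  \<open>x \<cdot> y = z\<close>. Autotopies are the triples of permutations acting on this set componentwise, so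
  conjugating them by the bijection permutes their components cyclically.\<close>

lemma autotopy_shift_iff:
  assumes f: "f permutes Q" and g: "g permutes Q" and h: "h permutes Q"
  shows "(conjugate \<alpha> h, conjugate \<beta> f, conjugate \<gamma> g) \<in> autotopies Q (\<cdot>)
    \<longleftrightarrow> (f, g, h) \<in> autotopies Q (\<cdot>)" (is "?S \<in> _ \<longleftrightarrow> _")
proof -
  note in_Q = permutes_in_image[OF f] permutes_in_image[OF g] permutes_in_image[OF h]
    permutes_in_image[OF perm_alpha] permutes_in_image[OF perm_beta]
    permutes_in_image[OF perm_gamma]
  note conj_apply = conjugate_apply[OF perm_alpha] conjugate_apply[OF perm_beta]
    conjugate_apply[OF perm_gamma]
  show ?thesis
  proof
    assume aut: "(f, g, h) \<in> autotopies Q (\<cdot>)"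
    show "?S \<in> autotopies Q (\<cdot>)"
    proof (rule autotopyI)
      fix u v assume u: "u \<in> Q" and v: "v \<in> Q"
      \<comment> \<open>Every pair \<open>(u, v)\<close> has the form \<open>(\<alpha> (x \<cdot> y), \<beta> x)\<close>.\<close>
      obtain x where x: "x \<in> Q" "v = \<beta> x" using permutes_image[OF perm_beta] v by blast
      obtain z where z: "z \<in> Q" "u = \<alpha> z" using permutes_image[OF perm_alpha] u by blast
      obtain y where y: "y \<in> Q" "x \<cdot> y = z" using right_solvable[OF x(1) z(1)] by blast
      have "conjugate \<alpha> h u \<cdot> conjugate \<beta> f v = \<alpha> (f x \<cdot> g y) \<cdot> \<beta> (f x)"
        using autotopyD(4)[OF aut x(1) y(1)] x y z by (simp add: conj_apply)
      also have "\<dots> = \<gamma> (g y)" using inverse_law x y in_Q by simp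
      also have "\<dots> = conjugate \<gamma> g (u \<cdot> v)"
        using inverse_law[OF x(1) y(1)] x y z conj_apply(3)[of g y] by simp
      finally show "conjugate \<alpha> h u \<cdot> conjugate \<beta> f v = conjugate \<gamma> g (u \<cdot> v)" .
    qed (use assms perm_alpha perm_beta perm_gamma conjugate_permutes in blast)+
  next
    assume aut: "?S \<in> autotopies Q (\<cdot>)"
    show "(f, g, h) \<in> autotopies Q (\<cdot>)"
    proof (rule autotopyI[OF f g h])
      fix x y assume x: "x \<in> Q" and y: "y \<in> Q"
      have fx: "f x \<in> Q" and hz: "h (x \<cdot> y) \<in> Q" using x y closed in_Q by auto
      obtain w where w: "w \<in> Q" "f x \<cdot> w = h (x \<cdot> y)" using right_solvable[OF fx hz] by blast
      have "\<gamma> w = \<alpha> (h (x \<cdot> y)) \<cdot> \<beta> (f x)" using inverse_law[OF fx w(1)] w(2) by simp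
      also have "\<dots> = conjugate \<gamma> g (\<alpha> (x \<cdot> y) \<cdot> \<beta> x)"
        using autotopyD(4)[OF aut, of "\<alpha> (x \<cdot> y)" "\<beta> x"] x y closed in_Q
        by (simp add: conj_apply)
      also have "\<dots> = \<gamma> (g y)" using inverse_law[OF x y] by (simp add: conj_apply)
      finally have "w = g y" using permutes_inj[OF perm_gamma] by (simp add: inj_eq)
      then show "f x \<cdot> g y = h (x \<cdot> y)" using w by simp
    qed
  qed
qed

lemma comp1_middle_eq_conjugate_left:
  "comp1 (middle_autotopy_nucleus Q (\<cdot>)) = conjugate \<alpha> ` comp3 (left_autotopy_nucleus Q (\<cdot>))"
proof (rule eq_conjugate_image[OF perm_alpha])
  fix h assume h: "h permutes Q"
  show "conjugate \<alpha> h \<in> comp1 (middle_autotopy_nucleus Q (\<cdot>))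
    \<longleftrightarrow> h \<in> comp3 (left_autotopy_nucleus Q (\<cdot>))"
  proof
    assume "h \<in> comp3 (left_autotopy_nucleus Q (\<cdot>))"
    then show "conjugate \<alpha> h \<in> comp1 (middle_autotopy_nucleus Q (\<cdot>))"
      using autotopy_shift_iff[OF h permutes_id h]
      by (auto simp: mem_comp1_middle_iff mem_comp3_left_iff conjugate_id_right[OF perm_gamma])
  next
    assume "conjugate \<alpha> h \<in> comp1 (middle_autotopy_nucleus Q (\<cdot>))"
    then obtain k where k: "(conjugate \<alpha> h, k, id) \<in> autotopies Q (\<cdot>)"
      by (auto simp: mem_comp1_middle_iff)
    let ?f = "conjugate (inv \<beta>) k"
    have f: "?f permutes Q"
      using conjugate_permutes[OF permutes_inv[OF perm_beta] autotopyD(2)[OF k]] .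
    have "(?f, id, h) \<in> autotopies Q (\<cdot>)"
      using autotopy_shift_iff[OF f permutes_id h] k
      by (simp add: conjugate_conjugate_inv[OF perm_beta] conjugate_id_right[OF perm_gamma])
    then show "h \<in> comp3 (left_autotopy_nucleus Q (\<cdot>))"
      using left_autotopy_components_eq mem_comp3_left_iff by metis
  qed
qed (auto simp: mem_comp1_middle_iff mem_comp3_left_iff dest: autotopyD(1))

lemma comp2_middle_eq_conjugate_left:
  "comp2 (middle_autotopy_nucleus Q (\<cdot>)) = conjugate \<beta> ` comp3 (left_autotopy_nucleus Q (\<cdot>))"
proof (rule eq_conjugate_image[OF perm_beta])
  fix f assume f: "f permutes Q"
  show "conjugate \<beta> f \<in> comp2 (middle_autotopy_nucleus Q (\<cdot>))
    \<longleftrightarrow> f \<in> comp3 (left_autotopy_nucleus Q (\<cdot>))"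
  proof
    assume "f \<in> comp3 (left_autotopy_nucleus Q (\<cdot>))"
    then show "conjugate \<beta> f \<in> comp2 (middle_autotopy_nucleus Q (\<cdot>))"
      using autotopy_shift_iff[OF f permutes_id f]
      by (auto simp: mem_comp2_middle_iff mem_comp3_left_iff conjugate_id_right[OF perm_gamma])
  next
    assume "conjugate \<beta> f \<in> comp2 (middle_autotopy_nucleus Q (\<cdot>))"
    then obtain k where k: "(k, conjugate \<beta> f, id) \<in> autotopies Q (\<cdot>)"
      by (auto simp: mem_comp2_middle_iff)
    let ?h = "conjugate (inv \<alpha>) k"
    have h: "?h permutes Q"
      using conjugate_permutes[OF permutes_inv[OF perm_alpha] autotopyD(1)[OF k]] .
    have "(f, id, ?h) \<in> autotopies Q (\<cdot>)"
      using autotopy_shift_iff[OF f permutes_id h] k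
      by (simp add: conjugate_conjugate_inv[OF perm_alpha] conjugate_id_right[OF perm_gamma])
    then show "f \<in> comp3 (left_autotopy_nucleus Q (\<cdot>))"
      using left_autotopy_components_eq mem_comp3_left_iff by metis
  qed
qed (auto simp: mem_comp2_middle_iff mem_comp3_left_iff dest: autotopyD(1,2))

lemma right_eq_conjugate_comp1_middle:
  "comp3 (right_autotopy_nucleus Q (\<cdot>)) = conjugate \<beta> ` comp1 (middle_autotopy_nucleus Q (\<cdot>))"
proof (rule eq_conjugate_image[OF perm_beta])
  fix f assume f: "f permutes Q"
  show "conjugate \<beta> f \<in> comp3 (right_autotopy_nucleus Q (\<cdot>))
    \<longleftrightarrow> f \<in> comp1 (middle_autotopy_nucleus Q (\<cdot>))"
  proof
    assume "f \<in> comp1 (middle_autotopy_nucleus Q (\<cdot>))"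
    then obtain g where g: "(f, g, id) \<in> autotopies Q (\<cdot>)"
      by (auto simp: mem_comp1_middle_iff)
    then have "(id, conjugate \<beta> f, conjugate \<gamma> g) \<in> autotopies Q (\<cdot>)"
      using autotopy_shift_iff[OF f autotopyD(2)[OF g] permutes_id]
      by (simp add: conjugate_id_right[OF perm_alpha])
    then show "conjugate \<beta> f \<in> comp3 (right_autotopy_nucleus Q (\<cdot>))"
      using right_autotopy_components_eq mem_comp3_right_iff by metis
  next
    assume "conjugate \<beta> f \<in> comp3 (right_autotopy_nucleus Q (\<cdot>))"
    then have k: "(id, conjugate \<beta> f, conjugate \<beta> f) \<in> autotopies Q (\<cdot>)"
      by (simp add: mem_comp3_right_iff)
    let ?g = "conjugate (inv \<gamma>) (conjugate \<beta> f)"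
    have g: "?g permutes Q"
      using conjugate_permutes[OF permutes_inv[OF perm_gamma] autotopyD(3)[OF k]] .
    have "(f, ?g, id) \<in> autotopies Q (\<cdot>)"
      using autotopy_shift_iff[OF f g permutes_id] k
      by (simp add: conjugate_conjugate_inv[OF perm_gamma] conjugate_id_right[OF perm_alpha])
    then show "f \<in> comp1 (middle_autotopy_nucleus Q (\<cdot>))"
      by (auto simp: mem_comp1_middle_iff)
  qed
qed (auto simp: mem_comp1_middle_iff mem_comp3_right_iff dest: autotopyD(1,2))

lemma right_eq_conjugate_comp2_middle:
  "comp3 (right_autotopy_nucleus Q (\<cdot>)) = conjugate \<gamma> ` comp2 (middle_autotopy_nucleus Q (\<cdot>))"
proof (rule eq_conjugate_image[OF perm_gamma])
  fix g assume g: "g permutes Q"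
  show "conjugate \<gamma> g \<in> comp3 (right_autotopy_nucleus Q (\<cdot>))
    \<longleftrightarrow> g \<in> comp2 (middle_autotopy_nucleus Q (\<cdot>))"
  proof
    assume "g \<in> comp2 (middle_autotopy_nucleus Q (\<cdot>))"
    then obtain f where f: "(f, g, id) \<in> autotopies Q (\<cdot>)"
      by (auto simp: mem_comp2_middle_iff)
    then have "(id, conjugate \<beta> f, conjugate \<gamma> g) \<in> autotopies Q (\<cdot>)"
      using autotopy_shift_iff[OF autotopyD(1)[OF f] g permutes_id]
      by (simp add: conjugate_id_right[OF perm_alpha])
    then show "conjugate \<gamma> g \<in> comp3 (right_autotopy_nucleus Q (\<cdot>))"
      using right_autotopy_components_eq mem_comp3_right_iff by metis
  next
    assume "conjugate \<gamma> g \<in> comp3 (right_autotopy_nucleus Q (\<cdot>))"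
    then have k: "(id, conjugate \<gamma> g, conjugate \<gamma> g) \<in> autotopies Q (\<cdot>)"
      by (simp add: mem_comp3_right_iff)
    let ?f = "conjugate (inv \<beta>) (conjugate \<gamma> g)"
    have f: "?f permutes Q"
      using conjugate_permutes[OF permutes_inv[OF perm_beta] autotopyD(2)[OF k]] .
    have "(?f, g, id) \<in> autotopies Q (\<cdot>)"
      using autotopy_shift_iff[OF f g permutes_id] k
      by (simp add: conjugate_conjugate_inv[OF perm_beta] conjugate_id_right[OF perm_alpha])
    then show "g \<in> comp2 (middle_autotopy_nucleus Q (\<cdot>))"
      by (auto simp: mem_comp2_middle_iff)
  qed
qed (auto simp: mem_comp2_middle_iff mem_comp3_right_iff dest: autotopyD(2))

lemma left_autotopy_shift_iff:
  assumes "g permutes Q"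
  shows "(conjugate \<alpha> g, id, conjugate \<gamma> g) \<in> autotopies Q (\<cdot>) \<longleftrightarrow> (id, g, g) \<in> autotopies Q (\<cdot>)"
  using autotopy_shift_iff[OF permutes_id assms assms] by (simp add: conjugate_id_right[OF perm_beta])

lemma left_eq_conjugate_alpha_right:
  "comp3 (left_autotopy_nucleus Q (\<cdot>)) = conjugate \<alpha> ` comp3 (right_autotopy_nucleus Q (\<cdot>))"
proof (rule eq_conjugate_image[OF perm_alpha])
  fix h assume h: "h permutes Q"
  show "conjugate \<alpha> h \<in> comp3 (left_autotopy_nucleus Q (\<cdot>))
    \<longleftrightarrow> h \<in> comp3 (right_autotopy_nucleus Q (\<cdot>))"
  proof
    assume "h \<in> comp3 (right_autotopy_nucleus Q (\<cdot>))"
    then have "(conjugate \<alpha> h, id, conjugate \<gamma> h) \<in> autotopies Q (\<cdot>)"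
      using left_autotopy_shift_iff[OF h] by (simp add: mem_comp3_right_iff)
    then show "conjugate \<alpha> h \<in> comp3 (left_autotopy_nucleus Q (\<cdot>))"
      using left_autotopy_components_eq mem_comp3_left_iff by metis
  next
    assume "conjugate \<alpha> h \<in> comp3 (left_autotopy_nucleus Q (\<cdot>))"
    then have k: "(conjugate \<alpha> h, id, conjugate \<alpha> h) \<in> autotopies Q (\<cdot>)"
      by (simp add: mem_comp3_left_iff)
    let ?g = "conjugate (inv \<gamma>) (conjugate \<alpha> h)"
    have g: "?g permutes Q"
      using conjugate_permutes[OF permutes_inv[OF perm_gamma] autotopyD(3)[OF k]] .
    have "(id, ?g, h) \<in> autotopies Q (\<cdot>)"
      using autotopy_shift_iff[OF permutes_id g h] k
      by (simp add: conjugate_conjugate_inv[OF perm_gamma] conjugate_id_right[OF perm_beta])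
    then show "h \<in> comp3 (right_autotopy_nucleus Q (\<cdot>))"
      using right_autotopy_components_eq mem_comp3_right_iff by metis
  qed
qed (auto simp: mem_comp3_left_iff mem_comp3_right_iff dest: autotopyD(1,2))

lemma left_eq_conjugate_gamma_right:
  "comp3 (left_autotopy_nucleus Q (\<cdot>)) = conjugate \<gamma> ` comp3 (right_autotopy_nucleus Q (\<cdot>))"
proof -
  have "conjugate \<alpha> g = conjugate \<gamma> g" if "g \<in> comp3 (right_autotopy_nucleus Q (\<cdot>))" for g
  proof -
    have "(id, g, g) \<in> autotopies Q (\<cdot>)" using that by (simp add: mem_comp3_right_iff)
    then show ?thesis
      using left_autotopy_components_eq left_autotopy_shift_iff[OF autotopyD(2)] by blast
  qed
  then show ?thesis using left_eq_conjugate_alpha_right by (simp cong: image_cong)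
qed

end


theorem theorem4p38:
  fixes Q :: "'a set" and opr :: "'a \<Rightarrow> 'a \<Rightarrow> 'a" and e :: 'a
    and \<alpha> \<beta> \<gamma> :: "'a \<Rightarrow> 'a"
  assumes "loop Q opr e"
    and "\<alpha> permutes Q" and "\<beta> permutes Q" and "\<gamma> permutes Q"
  shows "(inverse_loop Q opr e id \<beta> \<gamma> \<longrightarrow>
      comp1 (left_autotopy_nucleus Q opr) = comp3 (left_autotopy_nucleus Q opr) \<and>
      comp3 (left_autotopy_nucleus Q opr) = comp2 (right_autotopy_nucleus Q opr) \<and>
      comp2 (right_autotopy_nucleus Q opr) = comp3 (right_autotopy_nucleus Q opr) \<and>
      comp3 (right_autotopy_nucleus Q opr) = comp1 (middle_autotopy_nucleus Q opr) \<and>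
      left_nucleus Q opr = right_nucleus Q opr \<and>
      right_nucleus Q opr = middle_nucleus Q opr \<and>
      normal_subloop (middle_nucleus Q opr) Q opr e) \<and>
    (inverse_loop Q opr e \<alpha> id \<gamma> \<longrightarrow>
      comp1 (left_autotopy_nucleus Q opr) = comp3 (left_autotopy_nucleus Q opr) \<and>
      comp3 (left_autotopy_nucleus Q opr) = comp2 (middle_autotopy_nucleus Q opr) \<and>
      comp2 (right_autotopy_nucleus Q opr) = comp3 (right_autotopy_nucleus Q opr) \<and>
      comp3 (right_autotopy_nucleus Q opr) = comp1 (middle_autotopy_nucleus Q opr) \<and>
      left_nucleus Q opr = right_nucleus Q opr \<and>
      right_nucleus Q opr = middle_nucleus Q opr) \<and>
    (inverse_loop Q opr e \<alpha> \<beta> id \<longrightarrow>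
      comp1 (left_autotopy_nucleus Q opr) = comp3 (left_autotopy_nucleus Q opr) \<and>
      comp3 (left_autotopy_nucleus Q opr) = comp2 (right_autotopy_nucleus Q opr) \<and>
      comp2 (right_autotopy_nucleus Q opr) = comp3 (right_autotopy_nucleus Q opr) \<and>
      comp3 (right_autotopy_nucleus Q opr) = comp2 (middle_autotopy_nucleus Q opr) \<and>
      left_nucleus Q opr = right_nucleus Q opr \<and>
      right_nucleus Q opr = middle_nucleus Q opr \<and>
      normal_subloop (middle_nucleus Q opr) Q opr e) \<and>
    (inverse_loop Q opr e \<alpha> (inv \<alpha>) \<gamma> \<longrightarrow>
      comp1 (left_autotopy_nucleus Q opr) = comp3 (left_autotopy_nucleus Q opr) \<and>
      comp3 (left_autotopy_nucleus Q opr) = comp2 (right_autotopy_nucleus Q opr) \<and>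
      comp2 (right_autotopy_nucleus Q opr) = comp3 (right_autotopy_nucleus Q opr) \<and>
      comp3 (right_autotopy_nucleus Q opr) = comp2 (middle_autotopy_nucleus Q opr) \<and>
      left_nucleus Q opr = right_nucleus Q opr \<and>
      right_nucleus Q opr = middle_nucleus Q opr \<and>
      normal_subloop (middle_nucleus Q opr) Q opr e) \<and>
    (inverse_loop Q opr e \<alpha> \<beta> (inv \<alpha>) \<longrightarrow>
      comp1 (left_autotopy_nucleus Q opr) = comp3 (left_autotopy_nucleus Q opr) \<and>
      comp3 (left_autotopy_nucleus Q opr) = comp2 (middle_autotopy_nucleus Q opr) \<and>
      comp2 (right_autotopy_nucleus Q opr) = comp3 (right_autotopy_nucleus Q opr) \<and>
      comp3 (right_autotopy_nucleus Q opr) = comp1 (middle_autotopy_nucleus Q opr) \<and>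
      left_nucleus Q opr = right_nucleus Q opr \<and>
      right_nucleus Q opr = middle_nucleus Q opr) \<and>
    (inverse_loop Q opr e \<alpha> \<beta> (inv \<beta>) \<longrightarrow>
      comp1 (left_autotopy_nucleus Q opr) = comp3 (left_autotopy_nucleus Q opr) \<and>
      comp3 (left_autotopy_nucleus Q opr) = comp2 (right_autotopy_nucleus Q opr) \<and>
      comp2 (right_autotopy_nucleus Q opr) = comp3 (right_autotopy_nucleus Q opr) \<and>
      comp3 (right_autotopy_nucleus Q opr) = comp1 (middle_autotopy_nucleus Q opr) \<and>
      left_nucleus Q opr = right_nucleus Q opr \<and>
      right_nucleus Q opr = middle_nucleus Q opr \<and>
      normal_subloop (middle_nucleus Q opr) Q opr e)"
proof -
  interpret loop Q opr e by fact
  let ?L = "comp3 (left_autotopy_nucleus Q opr)"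
  let ?R = "comp3 (right_autotopy_nucleus Q opr)"
  let ?M1 = "comp1 (middle_autotopy_nucleus Q opr)"
  let ?M2 = "comp2 (middle_autotopy_nucleus Q opr)"
  let ?Nl = "left_nucleus Q opr" and ?Nr = "right_nucleus Q opr" and ?Nm = "middle_nucleus Q opr"
  note shifts = inverse_loop.comp1_middle_eq_conjugate_left
    inverse_loop.comp2_middle_eq_conjugate_left
    inverse_loop.right_eq_conjugate_comp1_middle inverse_loop.right_eq_conjugate_comp2_middle
    inverse_loop.left_eq_conjugate_alpha_right inverse_loop.left_eq_conjugate_gamma_right
  note same = comp1_left_eq_comp3_left comp2_right_eq_comp3_right
  note nuclei = left_nucleus_eq_image right_nucleus_eq_image
  have central1: "?Nl = ?Nr \<and> ?Nr = ?Nm \<and> normal_subloop ?Nm Q opr e"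
    if "?L = ?R" "?R = ?M1"
    using that nuclei middle_nucleus_eq_image_comp1 normal_subloop_middle_nucleus by simp
  have central2: "?Nl = ?Nr \<and> ?Nr = ?Nm \<and> normal_subloop ?Nm Q opr e"
    if "?L = ?R" "?R = ?M2"
    using that nuclei middle_nucleus_eq_image_comp2 normal_subloop_middle_nucleus by simp
  have noncentral: "?Nl = ?Nr \<and> ?Nr = ?Nm" if "?L = ?M2" "?R = ?M1"
    using that nuclei middle_nucleus_eq_image_comp1 middle_nucleus_eq_image_comp2 by simp

  have id_image: "conjugate id ` A = A" for A :: "('a \<Rightarrow> 'a) set" by simp
  note undo_alpha = conjugate_image_inv[OF assms(2)] conjugate_inv_image[OF assms(2)]
  note undo_beta = conjugate_image_inv[OF assms(3)] conjugate_inv_image[OF assms(3)]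

  have 1: "?L = ?R \<and> ?R = ?M1" if "inverse_loop Q opr e id \<beta> \<gamma>"
    using shifts[OF that] id_image by metis
  have 2: "?L = ?M2 \<and> ?R = ?M1" if "inverse_loop Q opr e \<alpha> id \<gamma>"
    using shifts[OF that] id_image by metis
  have 3: "?L = ?R \<and> ?R = ?M2" if "inverse_loop Q opr e \<alpha> \<beta> id"
    using shifts[OF that] id_image by metis
  have 4: "?L = ?R \<and> ?R = ?M2" if "inverse_loop Q opr e \<alpha> (inv \<alpha>) \<gamma>"
  proof -
    \<comment> \<open>\<open>\<L> = \<alpha> \<R> \<alpha>\<inverse>\<close>, so \<open>\<M>\<^sub>2 = \<alpha>\<inverse> \<L> \<alpha> = \<R>\<close>. Conjugation by \<open>\<gamma>\<close> maps \<open>\<M>\<^sub>2\<close> to \<open>\<R>\<close> and \<open>\<R>\<close> to \<open>\<L>\<close>.\<close>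
    have "?M2 = ?R" using shifts(2,5)[OF that] undo_alpha by metis
    then show ?thesis using shifts(4,6)[OF that] by metis
  qed
  have 5: "?L = ?M2 \<and> ?R = ?M1" if "inverse_loop Q opr e \<alpha> \<beta> (inv \<alpha>)"
    using shifts(1,4,5,6)[OF that] undo_alpha by metis
  have 6: "?L = ?R \<and> ?R = ?M1" if "inverse_loop Q opr e \<alpha> \<beta> (inv \<beta>)"
  proof -
    \<comment> \<open>Here \<open>\<M>\<^sub>2 = \<beta> \<L> \<beta>\<inverse>\<close>, and conjugation by \<open>\<gamma> = \<beta>\<inverse>\<close> maps \<open>\<M>\<^sub>2\<close> to \<open>\<R>\<close>, so \<open>\<R> = \<L>\<close>.\<close>
    have LR: "?L = ?R" using shifts(2,4)[OF that] undo_beta by metis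
    have "?R = ?M2" using shifts(6)[OF that] shifts(2)[OF that] LR undo_beta by metis
    then have "?M1 = ?L" using shifts(2,3)[OF that] undo_beta by metis
    then show ?thesis using LR by simp
  qed

  show ?thesis
    using 1 2 3 4 5 6 central1 central2 noncentral unfolding same by metis
qed

end
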